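(* Let $\alpha,\beta,\sigma>0$ and $\mu\in\mathbb{R}$. Let $h$ be the hazard rate function of the beta normal distribution $\mathrm{BN}(\alpha,\beta,\mu,\sigma)$ and $h_{\mathrm{N}}$ the hazard rate function of the normal distribution with mean $\mu$ and standard deviation $\sigma$. Then $h(x)\to 0$ as $x\to-\infty$, and, as $x\to-\infty$, $$h(x)\sim\frac{1}{\sigma\,\mathrm{B}(\alpha,\beta)}\left(-\frac{x-\mu}{\sigma}\right)^{1-\alpha}\left[\phi\left(\frac{x-\mu}{\sigma}\right)\right]^{\alpha}$$ and $$h(x)\sim\frac{1}{\mathrm{B}(\alpha,\beta)\,\sigma^{1-\alpha}}\left(-\frac{x-\mu}{\sigma}\right)^{1-\alpha}\left[h_{\mathrm{N}}(x)\right]^{\alpha}.$$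
   Context: $\Phi$ and $\phi$ denote the standard normal cumulative distribution function and density, $\mathrm{B}(\cdot,\cdot)$ is the beta function, and $I_y(\alpha,\beta)=\mathrm{B}(\alpha,\beta)^{-1}\int_0^y w^{\alpha-1}(1-w)^{\beta-1}\,\mathrm{d}w$ is the incomplete beta function ratio. The hazard rate function of $\mathrm{BN}(\alpha,\beta,\mu,\sigma)$ is $$h(x)=\frac{\left[\Phi\left(\frac{x-\mu}{\sigma}\right)\right]^{\alpha-1}\left[1-\Phi\left(\frac{x-\mu}{\sigma}\right)\right]^{\beta-1}\phi\left(\frac{x-\mu}{\sigma}\right)}{\sigma\,\mathrm{B}(\alpha,\beta)\left[1-I_{\Phi\left(\frac{x-\mu}{\sigma}\right)}(\alpha,\beta)\right]},\qquad x\in\mathbb{R},$$ and that of the normal distribution is $$h_{\mathrm{N}}(x)=\frac{\phi\left(\frac{x-\mu}{\sigma}\right)}{\sigma\left[1-\Phi\left(\frac{x-\mu}{\sigma}\right)\right]}.$$ $a(x)\sim b(x)$ means $a(x)/b(x)\to 1$ in the indicated limit. *)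

theory Defs
  imports "HOL-Probability.Probability" "HOL-Library.Landau_Symbols"
begin

abbreviation Phi :: "real \<Rightarrow> real" where
  "Phi \<equiv> cdf std_normal_distribution"

definition inc_beta_ratio :: "real \<Rightarrow> real \<Rightarrow> real \<Rightarrow> real" where
  "inc_beta_ratio \<alpha> \<beta> y =
     integral {0..y} (\<lambda>w. w powr (\<alpha> - 1) * (1 - w) powr (\<beta> - 1)) / Beta \<alpha> \<beta>"

definition beta_normal_hazard :: "real \<Rightarrow> real \<Rightarrow> real \<Rightarrow> real \<Rightarrow> real \<Rightarrow> real" where
  "beta_normal_hazard \<alpha> \<beta> \<mu> \<sigma> x =
     Phi ((x - \<mu>) / \<sigma>) powr (\<alpha> - 1) * (1 - Phi ((x - \<mu>) / \<sigma>)) powr (\<beta> - 1)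
       * std_normal_density ((x - \<mu>) / \<sigma>)
     / (\<sigma> * Beta \<alpha> \<beta> * (1 - inc_beta_ratio \<alpha> \<beta> (Phi ((x - \<mu>) / \<sigma>))))"

definition normal_hazard :: "real \<Rightarrow> real \<Rightarrow> real \<Rightarrow> real" where
  "normal_hazard \<mu> \<sigma> x =
     std_normal_density ((x - \<mu>) / \<sigma>) / (\<sigma> * (1 - Phi ((x - \<mu>) / \<sigma>)))"

end

theory Submission
  imports Defs "HOL-Real_Asymp.Real_Asymp"
begin

text \<open>
  In the standardized variable \<open>t = (x - \<mu>) / \<sigma>\<close>, write \<open>\<phi>\<close> for the standard normal density.
  Apart from the constant \<open>1 / (\<sigma> Beta \<alpha> \<beta>)\<close>, the hazard rate is a product of
  \<open>Phi t powr (\<alpha> - 1) * \<phi> t\<close> with factors that are functions of \<open>p = Phi t\<close> alone and tend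
  to \<open>1\<close> as \<open>p \<rightarrow> 0\<close> from the right; as \<open>Phi t \<rightarrow> 0\<close> in the left tail, these factors are
  invisible asymptotically. For the survival factor this is the continuity of the indefinite
  integral of the beta density, which holds even if the integrand is unbounded at \<open>0\<close>.

  What remains is the Mills ratio of the left tail, \<open>Phi t \<sim> \<phi> t / (- t)\<close>
  (\<open>Phi_asymp_at_bot\<close>), obtained by squeezing the quotient between \<open>Phi t\<close> and
  \<open>(1 + 1 / t\<^sup>2) Phi t\<close>; both bounds hold because the differences vanish at \<open>-\<infinity>\<close> and are
  strictly increasing on the negative half-line. The Mills ratio turns
  \<open>Phi t powr (\<alpha> - 1) * \<phi> t\<close> into \<open>(- t) powr (1 - \<alpha>) * \<phi> t powr \<alpha>\<close>. The latter tends to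
  \<open>0\<close>, as the Gaussian decay beats every power, and so does the hazard rate. Finally the
  normal hazard rate is asymptotic to \<open>\<phi> t / \<sigma>\<close>, since its survival factor tends to \<open>1\<close> as
  well, so that replacing \<open>\<phi> t\<close> by \<open>\<sigma>\<close> times the normal hazard rate gives the second
  equivalence.
\<close>

lemma Phi_conv_integral:
  assumes "a \<le> x"
  shows "Phi x = Phi a + integral {a..x} std_normal_density"
proof (cases "a = x")
  case False
  interpret real_distribution std_normal_distribution
    by (rule real_dist_normal_dist)
  have "Phi x - Phi a = measure std_normal_distribution {a<..x}"
    using assms False by (intro cdf_diff_eq) auto
  also have "\<dots> = (LINT y|std_normal_distribution. indicator {a<..x} y)"
    by simp
  also have "\<dots> = (LINT y|lborel. std_normal_density y * indicator {a<..x} y)"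
    by (subst integral_density) auto
  also have "\<dots> = (LINT y:{a<..x}|lborel. std_normal_density y)"
    by (simp add: set_lebesgue_integral_def mult.commute)
  also have "\<dots> = integral {a<..x} std_normal_density"
    using integrable_mult_indicator[of "{a<..x}" lborel std_normal_density]
    by (intro set_borel_integral_eq_integral) (simp add: set_integrable_def)
  also have "\<dots> = integral {a..x} std_normal_density"
    by (rule integral_spike_set; rule negligible_subset[of "{a}"]) auto
  finally show ?thesis by simp
qed simp

lemma continuous_on_std_normal_density: "continuous_on A std_normal_density"
  unfolding std_normal_density_def by (intro continuous_intros) auto

lemma Phi_has_real_derivative [derivative_intros]:
  assumes "(f has_real_derivative D) (at t within A)"
  shows "((\<lambda>t. Phi (f t)) has_real_derivative (std_normal_density (f t) * D)) (at t within A)"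
proof -
  have "(Phi has_real_derivative std_normal_density x) (at x)" for x
  proof -
    have "((\<lambda>y. Phi (x - 1) + integral {x - 1..y} std_normal_density) has_real_derivative
             0 + std_normal_density x) (at x within {x - 1..x + 1})"
      by (intro DERIV_add DERIV_const integral_has_real_derivative
          continuous_on_std_normal_density) auto
    hence "((\<lambda>y. Phi (x - 1) + integral {x - 1..y} std_normal_density) has_real_derivative
             std_normal_density x) (at x)"
      by (subst (asm) at_within_interior) auto
    thus ?thesis
      by (rule DERIV_cong_ev[THEN iffD1, rotated 3])
         (auto intro!: eventually_nhds_in_open[of "{x - 1<..}", THEN eventually_mono]
               Phi_conv_integral[symmetric])
  qed
  from DERIV_chain2[OF this assms] show ?thesis .
qed

lemma std_normal_density_has_real_derivative [derivative_intros]: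
  assumes "(f has_real_derivative D) (at t within A)"
  shows "((\<lambda>t. std_normal_density (f t)) has_real_derivative
           (- f t * std_normal_density (f t) * D)) (at t within A)"
proof -
  have "((\<lambda>t. exp (- (f t)\<^sup>2 / 2)) has_real_derivative
          (- f t * exp (- (f t)\<^sup>2 / 2) * D)) (at t within A)"
    by (auto intro!: derivative_eq_intros assms)
  from DERIV_cmult[OF this, of "1 / sqrt (2 * pi)"] show ?thesis
    by (simp add: std_normal_density_def field_simps)
qed

lemma Phi_tendsto_0_at_bot: "(Phi \<longlongrightarrow> 0) at_bot"
proof -
  interpret real_distribution std_normal_distribution
    by (rule real_dist_normal_dist)
  show ?thesis by (rule cdf_lim_at_bot)
qed

lemma Phi_pos: "Phi t > 0"
  by (rule DERIV_pos_imp_increasing_at_bot[OF _ Phi_tendsto_0_at_bot])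
     (auto intro!: derivative_eq_intros exI normal_density_pos)

lemma Mills_quotient_has_real_derivative:
  assumes "x < 0"
  shows "((\<lambda>x. std_normal_density x / (- x)) has_real_derivative
           std_normal_density x * (1 + 1 / x\<^sup>2)) (at x)"
proof -
  have "((\<lambda>x. - x) has_real_derivative - 1) (at x)"
    by (auto intro!: derivative_eq_intros)
  from DERIV_divide[OF std_normal_density_has_real_derivative[OF DERIV_ident] this] assms
  show ?thesis by (simp add: field_simps power2_eq_square)
qed

lemma Mills_quotient_tendsto_0: "((\<lambda>x. std_normal_density x / (- x)) \<longlongrightarrow> 0) at_bot"
  unfolding std_normal_density_def by real_asymp

text \<open>The difference of the two sides vanishes at \<open>-\<infinity>\<close>, and its derivative is
  \<open>\<phi> t / t\<^sup>2 > 0\<close>, where \<open>\<phi>\<close> is the density.\<close>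

lemma Phi_less_Mills:
  assumes "t < 0"
  shows "Phi t < std_normal_density t / (- t)"
proof -
  have "0 < std_normal_density t / (- t) - Phi t"
  proof (rule DERIV_pos_imp_increasing_at_bot[where b = t])
    fix x assume "x \<le> t"
    hence "x < 0" using assms by simp
    hence "((\<lambda>x. std_normal_density x / (- x) - Phi x) has_real_derivative
             std_normal_density x / x\<^sup>2) (at x)"
      using DERIV_diff[OF Mills_quotient_has_real_derivative Phi_has_real_derivative[OF DERIV_ident], of x]
      by (simp add: algebra_simps)
    moreover have "std_normal_density x / x\<^sup>2 > 0"
      using \<open>x < 0\<close> by (simp add: normal_density_pos)
    ultimately show "\<exists>y. ((\<lambda>x. std_normal_density x / (- x) - Phi x) has_real_derivative y) (at x)
                        \<and> y > 0"
      by blast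
  next
    from tendsto_diff[OF Mills_quotient_tendsto_0 Phi_tendsto_0_at_bot]
    show "((\<lambda>x. std_normal_density x / (- x) - Phi x) \<longlongrightarrow> 0) at_bot" by simp
  qed
  thus ?thesis by simp
qed

text \<open>The matching lower bound: the factor \<open>1 + 1 / t\<^sup>2\<close> is chosen because
  \<open>(\<phi> t / (- t))' = (1 + 1 / t\<^sup>2) \<phi> t\<close>, so that in the derivative of the difference
  only the positive term \<open>- 2 Phi t / t ^ 3\<close> survives.\<close>

lemma Mills_less_Phi:
  assumes "t < 0"
  shows "std_normal_density t / (- t) < Phi t * (1 + 1 / t\<^sup>2)"
proof -
  have "0 < Phi t * (1 + 1 / t\<^sup>2) - std_normal_density t / (- t)"
  proof (rule DERIV_pos_imp_increasing_at_bot[where b = t])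
    fix x assume "x \<le> t"
    hence "x < 0" using assms by simp
    hence "((\<lambda>x. 1 + 1 / x\<^sup>2) has_real_derivative (- 2 / x ^ 3)) (at x)"
      by (auto intro!: derivative_eq_intros simp: field_simps power2_eq_square power3_eq_cube)
    from DERIV_diff[OF DERIV_mult[OF Phi_has_real_derivative[OF DERIV_ident] this]
        Mills_quotient_has_real_derivative[OF \<open>x < 0\<close>]]
    have "((\<lambda>x. Phi x * (1 + 1 / x\<^sup>2) - std_normal_density x / (- x)) has_real_derivative
             (- 2 * Phi x / x ^ 3)) (at x)"
      by (simp add: algebra_simps)
    moreover have "- 2 * Phi x / x ^ 3 > 0"
      using \<open>x < 0\<close> Phi_pos[of x] by (intro divide_neg_neg) (auto simp: power_less_zero_eq)
    ultimately show "\<exists>y. ((\<lambda>x. Phi x * (1 + 1 / x\<^sup>2) - std_normal_density x / (- x))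
                           has_real_derivative y) (at x) \<and> y > 0"
      by blast
  next
    have 1: "((\<lambda>x::real. 1 + 1 / x\<^sup>2) \<longlongrightarrow> 1) at_bot"
      by real_asymp
    from tendsto_diff[OF tendsto_mult[OF Phi_tendsto_0_at_bot 1] Mills_quotient_tendsto_0]
    show "((\<lambda>x. Phi x * (1 + 1 / x\<^sup>2) - std_normal_density x / (- x)) \<longlongrightarrow> 0) at_bot" by simp
  qed
  thus ?thesis by simp
qed

lemma Phi_asymp_at_bot: "Phi \<sim>[at_bot] (\<lambda>t. std_normal_density t / (- t))"
proof (rule asymp_equiv_symI,
    rule asymp_equiv_sandwich_real[where l = Phi and u = "\<lambda>t. Phi t * (1 + 1 / t\<^sup>2)"])
  have "(\<lambda>t::real. 1 + 1 / t\<^sup>2) \<sim>[at_bot] (\<lambda>_. 1)"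
    by real_asymp
  from asymp_equiv_mult[OF asymp_equiv_refl[of Phi] this]
  show "(\<lambda>t. Phi t * (1 + 1 / t\<^sup>2)) \<sim>[at_bot] Phi" by simp
  show "Phi \<sim>[at_bot] Phi" by simp
  show "eventually (\<lambda>t. std_normal_density t / (- t) \<in> {Phi t..Phi t * (1 + 1 / t\<^sup>2)}) at_bot"
    using eventually_gt_at_bot[of 0]
    by eventually_elim (use Phi_less_Mills Mills_less_Phi in \<open>force intro: less_imp_le\<close>)
qed

lemma inc_beta_ratio_tendsto_0:
  assumes "\<alpha> > 0" "\<beta> > 0"
  shows "(inc_beta_ratio \<alpha> \<beta> \<longlongrightarrow> 0) (at_right 0)"
proof -
  define f where "f = (\<lambda>w. w powr (\<alpha> - 1) * (1 - w) powr (\<beta> - 1) :: real)"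
  have "f integrable_on {0..1}"
    using has_integral_Beta_real[OF assms] unfolding f_def by (rule has_integral_integrable)
  hence "continuous_on {0..1} (\<lambda>y. integral {0..y} f)"
    by (rule indefinite_integral_continuous_1)
  hence "((\<lambda>y. integral {0..y} f) \<longlongrightarrow> integral {0..0} f) (at_right 0)"
    by (rule continuous_on_Icc_at_rightD) auto
  from tendsto_divide_zero[OF this[simplified], of "Beta \<alpha> \<beta>"] show ?thesis
    unfolding inc_beta_ratio_def f_def .
qed

text \<open>The left-hand side is \<open>\<sigma> * Beta \<alpha> \<beta>\<close> times the hazard rate in the standardized variable.
  In the Mills ratio raised to the power \<open>\<alpha> - 1\<close>, the density combines with the remaining
  factor \<open>\<phi> t\<close> to \<open>\<phi> t powr \<alpha>\<close>.\<close>

lemma beta_normal_tail_asymp: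
  assumes "\<alpha> > 0" "\<beta> > 0"
  shows "(\<lambda>t. Phi t powr (\<alpha> - 1) * (1 - Phi t) powr (\<beta> - 1) * std_normal_density t
                / (1 - inc_beta_ratio \<alpha> \<beta> (Phi t)))
           \<sim>[at_bot] (\<lambda>t. (- t) powr (1 - \<alpha>) * std_normal_density t powr \<alpha>)"
proof -
  have neg: "eventually (\<lambda>t::real. t < 0) at_bot"
    by (rule eventually_gt_at_bot)
  have "(\<lambda>t. Phi t powr (\<alpha> - 1)) \<sim>[at_bot] (\<lambda>t. (std_normal_density t / (- t)) powr (\<alpha> - 1))"
  proof (intro asymp_equiv_powr_real Phi_asymp_at_bot)
    show "eventually (\<lambda>t. 0 \<le> std_normal_density t / (- t)) at_bot"
      using neg by eventually_elim (auto intro!: divide_nonneg_neg)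
  qed (simp add: Phi_pos less_imp_le)
  moreover have "(\<lambda>t. (1 - Phi t) powr (\<beta> - 1)) \<sim>[at_bot] (\<lambda>_. 1)"
    by (rule tendsto_imp_asymp_equiv_const) (auto intro!: tendsto_eq_intros Phi_tendsto_0_at_bot)
  moreover have "filterlim Phi (at_right 0) at_bot"
    by (intro filterlim_atI tendsto_imp_filterlim_at_right Phi_tendsto_0_at_bot) (auto simp: Phi_pos)
  from filterlim_compose[OF inc_beta_ratio_tendsto_0[OF assms] this]
  have "(\<lambda>t. 1 - inc_beta_ratio \<alpha> \<beta> (Phi t)) \<sim>[at_bot] (\<lambda>_. 1)"
    by (intro tendsto_imp_asymp_equiv_const) (auto intro!: tendsto_eq_intros)
  ultimately have "(\<lambda>t. Phi t powr (\<alpha> - 1) * (1 - Phi t) powr (\<beta> - 1) * std_normal_density t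
                / (1 - inc_beta_ratio \<alpha> \<beta> (Phi t)))
           \<sim>[at_bot] (\<lambda>t. (std_normal_density t / (- t)) powr (\<alpha> - 1) * 1 * std_normal_density t / 1)"
    by (intro asymp_equiv_mult asymp_equiv_divide asymp_equiv_refl)
  also have "eventually (\<lambda>t. (std_normal_density t / (- t)) powr (\<alpha> - 1) * 1 * std_normal_density t / 1
       = (- t) powr (1 - \<alpha>) * std_normal_density t powr \<alpha>) at_bot"
    using neg
  proof eventually_elim
    case (elim t)
    have "(std_normal_density t / (- t)) powr (\<alpha> - 1) * std_normal_density t
        = (std_normal_density t powr (\<alpha> - 1) * std_normal_density t) / (- t) powr (\<alpha> - 1)"
      using elim by (subst powr_divide) auto
    also have "std_normal_density t powr (\<alpha> - 1) * std_normal_density t = std_normal_density t powr \<alpha>"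
      using normal_density_pos[of 1 0 t] by (simp add: powr_diff)
    also have "\<dots> / (- t) powr (\<alpha> - 1) = (- t) powr (1 - \<alpha>) * std_normal_density t powr \<alpha>"
      using powr_minus_divide[of "- t" "\<alpha> - 1"] by simp
    finally show ?case by simp
  qed
  finally show ?thesis .
qed

lemma tail_tendsto_0:
  assumes "\<alpha> > 0"
  shows "((\<lambda>t. (- t) powr (1 - \<alpha>) * std_normal_density t powr \<alpha>) \<longlongrightarrow> 0) at_bot"
  unfolding std_normal_density_def using assms by real_asymp

theorem mainTheorem7:
  fixes \<alpha> \<beta> \<mu> \<sigma> :: real
  assumes "\<alpha> > 0" and "\<beta> > 0" and "\<sigma> > 0"
  shows "(beta_normal_hazard \<alpha> \<beta> \<mu> \<sigma> \<longlongrightarrow> 0) at_bot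
    \<and> beta_normal_hazard \<alpha> \<beta> \<mu> \<sigma> \<sim>[at_bot]
        (\<lambda>x. 1 / (\<sigma> * Beta \<alpha> \<beta>) * (- ((x - \<mu>) / \<sigma>)) powr (1 - \<alpha>)
              * std_normal_density ((x - \<mu>) / \<sigma>) powr \<alpha>)
    \<and> beta_normal_hazard \<alpha> \<beta> \<mu> \<sigma> \<sim>[at_bot]
        (\<lambda>x. 1 / (Beta \<alpha> \<beta> * \<sigma> powr (1 - \<alpha>)) * (- ((x - \<mu>) / \<sigma>)) powr (1 - \<alpha>)
              * normal_hazard \<mu> \<sigma> x powr \<alpha>)"
proof (intro conjI)
  define B where "B = Beta \<alpha> \<beta>"
  define s where "s = (\<lambda>x. (x - \<mu>) / \<sigma>)"
  have s: "filterlim s at_bot at_bot"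
    unfolding s_def using \<open>\<sigma> > 0\<close> by real_asymp
  let ?g = "\<lambda>x. 1 / (\<sigma> * B) * (- s x) powr (1 - \<alpha>) * std_normal_density (s x) powr \<alpha>"
  let ?k = "\<lambda>x. 1 / (B * \<sigma> powr (1 - \<alpha>)) * (- s x) powr (1 - \<alpha>) * normal_hazard \<mu> \<sigma> x powr \<alpha>"
  have hg: "beta_normal_hazard \<alpha> \<beta> \<mu> \<sigma> \<sim>[at_bot] ?g"
  proof -
    have eq: "beta_normal_hazard \<alpha> \<beta> \<mu> \<sigma> = (\<lambda>x. 1 / (\<sigma> * B) *
        (Phi (s x) powr (\<alpha> - 1) * (1 - Phi (s x)) powr (\<beta> - 1) * std_normal_density (s x)
                / (1 - inc_beta_ratio \<alpha> \<beta> (Phi (s x)))))"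
      by (simp add: fun_eq_iff beta_normal_hazard_def s_def B_def)
    show ?thesis
      unfolding eq mult.assoc[of "1 / (\<sigma> * B)"]
      by (intro asymp_equiv_mult asymp_equiv_refl
            asymp_equiv_compose'[OF beta_normal_tail_asymp[OF assms(1,2)] s])
  qed
  thus "beta_normal_hazard \<alpha> \<beta> \<mu> \<sigma> \<sim>[at_bot]
        (\<lambda>x. 1 / (\<sigma> * Beta \<alpha> \<beta>) * (- ((x - \<mu>) / \<sigma>)) powr (1 - \<alpha>)
              * std_normal_density ((x - \<mu>) / \<sigma>) powr \<alpha>)"
    unfolding s_def B_def .

  have "(?g \<longlongrightarrow> 0) at_bot"
    using tendsto_mult_right_zero[OF filterlim_compose[OF tail_tendsto_0[OF assms(1)] s],
        of "1 / (\<sigma> * B)"]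
    unfolding mult.assoc[of "1 / (\<sigma> * B)"] .
  thus "(beta_normal_hazard \<alpha> \<beta> \<mu> \<sigma> \<longlongrightarrow> 0) at_bot"
    using tendsto_asymp_equiv_cong[OF hg] by blast

  have Phi_s: "((\<lambda>x. Phi (s x)) \<longlongrightarrow> 0) at_bot"
    by (rule filterlim_compose[OF Phi_tendsto_0_at_bot s])
  have "(\<lambda>x. 1 - Phi (s x)) \<sim>[at_bot] (\<lambda>_. 1)"
    by (rule tendsto_imp_asymp_equiv_const) (auto intro!: tendsto_eq_intros Phi_s)
  hence "(\<lambda>x. std_normal_density (s x) / (\<sigma> * (1 - Phi (s x))))
           \<sim>[at_bot] (\<lambda>x. std_normal_density (s x) / (\<sigma> * 1))"
    by (intro asymp_equiv_divide asymp_equiv_mult asymp_equiv_refl)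
  hence "normal_hazard \<mu> \<sigma> \<sim>[at_bot] (\<lambda>x. std_normal_density (s x) / \<sigma>)"
    unfolding normal_hazard_def[abs_def] s_def by simp
  moreover have "eventually (\<lambda>x. normal_hazard \<mu> \<sigma> x \<ge> 0) at_bot"
    using order_tendstoD(2)[OF Phi_s zero_less_one]
    by eventually_elim (use \<open>\<sigma> > 0\<close> in \<open>auto simp: normal_hazard_def s_def\<close>)
  ultimately have "(\<lambda>x. normal_hazard \<mu> \<sigma> x powr \<alpha>)
      \<sim>[at_bot] (\<lambda>x. (std_normal_density (s x) / \<sigma>) powr \<alpha>)"
    using \<open>\<sigma> > 0\<close> by (intro asymp_equiv_powr_real) auto
  hence "?k \<sim>[at_bot] (\<lambda>x. 1 / (B * \<sigma> powr (1 - \<alpha>)) * (- s x) powr (1 - \<alpha>)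
            * (std_normal_density (s x) / \<sigma>) powr \<alpha>)"
    by (intro asymp_equiv_mult asymp_equiv_refl)
  moreover have "(\<lambda>x. 1 / (B * \<sigma> powr (1 - \<alpha>)) * (- s x) powr (1 - \<alpha>)
            * (std_normal_density (s x) / \<sigma>) powr \<alpha>) = ?g"
    using \<open>\<sigma> > 0\<close> by (simp add: fun_eq_iff powr_divide powr_diff)
  ultimately have "?k \<sim>[at_bot] ?g" by (simp only:)
  hence "beta_normal_hazard \<alpha> \<beta> \<mu> \<sigma> \<sim>[at_bot] ?k"
    by (rule asymp_equiv_trans[OF hg asymp_equiv_symI])
  thus "beta_normal_hazard \<alpha> \<beta> \<mu> \<sigma> \<sim>[at_bot]
        (\<lambda>x. 1 / (Beta \<alpha> \<beta> * \<sigma> powr (1 - \<alpha>)) * (- ((x - \<mu>) / \<sigma>)) powr (1 - \<alpha>)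
              * normal_hazard \<mu> \<sigma> x powr \<alpha>)"
    unfolding s_def B_def .
qed

end
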